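(* Let $H\in\mathbb{R}^{n\times n}$ be positive semidefinite, $h\in\mathbb{R}^n$, $f(x)=\tfrac12\langle Hx,x\rangle+\langle h,x\rangle$, and let $g:\mathbb{R}^n\to\mathbb{R}\cup\{\infty\}$ be proper, closed and convex. Let $L=\lambda_{\max}(H)$ and $\gamma\in(0,\tfrac1L)$. Then the Douglas-Rachford envelope $F_\gamma^{\mathrm{DR}}$ (defined in the context) satisfies $$\tfrac1{4\gamma}\|z-y\|_{P-P^2}^2\le F_\gamma^{\mathrm{DR}}(z)-F_\gamma^{\mathrm{DR}}(y)-\langle\nabla F_\gamma^{\mathrm{DR}}(y),z-y\rangle\le\tfrac1{4\gamma}\|z-y\|_{P+P^2}^2$$ for all $y,z\in\mathbb{R}^n$, where $P=2(\mathrm{Id}+\gamma H)^{-1}-\mathrm{Id}$ is positive definite. If in addition $\lambda_{\min}(H)=m>0$, then $P-P^2$ is positive definite and $F_\gamma^{\mathrm{DR}}$ is $(2\gamma)^{-1}$-strongly convex with respect to $\|\cdot\|_{P-P^2}$.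
   Context: $\langle\cdot,\cdot\rangle$ is an inner product on $\mathbb{R}^n$ with induced norm $\|\cdot\|$. For a positive semidefinite operator $Q$ (self-adjoint with nonnegative eigenvalues), $\|x\|_Q^2=\langle Qx,x\rangle$. For positive definite $Q$ and $\sigma>0$, a function $\phi$ is $\sigma$-strongly convex with respect to $\|\cdot\|_Q$ if $\phi-\tfrac\sigma2\|\cdot\|_Q^2$ is convex. The conjugate of $\phi$ is $\phi^*(y)=\sup_x\{\langle y,x\rangle-\phi(x)\}$. For a proper closed convex $\phi$ and $\gamma>0$: $\mathrm{prox}_{\gamma\phi}(z)=\operatorname{argmin}_x\{\phi(x)+\tfrac1{2\gamma}\|x-z\|^2\}$; $r_{\gamma\phi}(x)=\gamma\phi(x)+\tfrac12\|x\|^2$, whose conjugate satisfies $\nabla r_{\gamma\phi}^*=\mathrm{prox}_{\gamma\phi}$; $p_{\gamma\phi}^2(x)=2r_{\gamma\phi}^*(x)-\tfrac12\|x\|^2$; and $R_{\gamma\phi}=\nabla p_{\gamma\phi}^2=2\,\mathrm{prox}_{\gamma\phi}-\mathrm{Id}$. The Douglas-Rachford envelope is $$F_\gamma^{\mathrm{DR}}(z)=(2\gamma)^{-1}\big(\langle R_{\gamma f}(z),z\rangle-p_{\gamma f}^2(z)-p_{\gamma g}^2(R_{\gamma f}(z))\big).$$ If $L=0$, the interval $(0,1/L)$ is read as $(0,\infty)$. *)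

theory Defs
  imports "HOL-Analysis.Analysis"
begin

text \<open>\<open>\<real>\<^sup>n\<close> with an arbitrary inner product is an arbitrary type of class \<open>euclidean_space\<close>; matrices are
  linear operators on it.\<close>

definition eigenvalues :: "('a::euclidean_space \<Rightarrow> 'a) \<Rightarrow> real set" where
  "eigenvalues Q = {c. \<exists>v. v \<noteq> 0 \<and> Q v = c *\<^sub>R v}"

definition lambda_max :: "('a::euclidean_space \<Rightarrow> 'a) \<Rightarrow> real" where
  "lambda_max Q = Max (eigenvalues Q)"

definition lambda_min :: "('a::euclidean_space \<Rightarrow> 'a) \<Rightarrow> real" where
  "lambda_min Q = Min (eigenvalues Q)"

definition self_adjoint :: "('a::euclidean_space \<Rightarrow> 'a) \<Rightarrow> bool" where
  "self_adjoint Q \<longleftrightarrow> linear Q \<and> (\<forall>x y. Q x \<bullet> y = x \<bullet> Q y)"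

definition pos_semidef :: "('a::euclidean_space \<Rightarrow> 'a) \<Rightarrow> bool" where
  "pos_semidef Q \<longleftrightarrow> self_adjoint Q \<and> (\<forall>c\<in>eigenvalues Q. 0 \<le> c)"

definition pos_def :: "('a::euclidean_space \<Rightarrow> 'a) \<Rightarrow> bool" where
  "pos_def Q \<longleftrightarrow> self_adjoint Q \<and> (\<forall>c\<in>eigenvalues Q. 0 < c)"

text \<open>\<open>sqnorm Q x\<close> is the squared norm \<open>\<parallel>x\<parallel>\<^sub>Q\<^sup>2\<close>.\<close>

definition sqnorm :: "('a::euclidean_space \<Rightarrow> 'a) \<Rightarrow> 'a \<Rightarrow> real" where
  "sqnorm Q x = Q x \<bullet> x"

definition strongly_convex_wrt :: "('a::euclidean_space \<Rightarrow> 'a) \<Rightarrow> real \<Rightarrow> ('a \<Rightarrow> real) \<Rightarrow> bool" where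
  "strongly_convex_wrt Q \<sigma> \<phi> \<longleftrightarrow> convex_on UNIV (\<lambda>x. \<phi> x - \<sigma> / 2 * sqnorm Q x)"

definition gradient :: "('a::euclidean_space \<Rightarrow> real) \<Rightarrow> 'a \<Rightarrow> 'a" where
  "gradient F y = (THE D. GDERIV F y :> D)"

definition epi :: "('a::euclidean_space \<Rightarrow> ereal) \<Rightarrow> ('a \<times> real) set" where
  "epi \<phi> = {(x, r). \<phi> x \<le> ereal r}"

definition proper_closed_convex :: "('a::euclidean_space \<Rightarrow> ereal) \<Rightarrow> bool" where
  "proper_closed_convex \<phi> \<longleftrightarrow>
     (\<forall>x. \<phi> x \<noteq> -\<infinity>) \<and> (\<exists>x. \<phi> x \<noteq> \<infinity>) \<and> closed (epi \<phi>) \<and> convex (epi \<phi>)"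

definition conjugate :: "('a::euclidean_space \<Rightarrow> ereal) \<Rightarrow> 'a \<Rightarrow> ereal" where
  "conjugate \<phi> y = (SUP x. ereal (y \<bullet> x) - \<phi> x)"

definition prox :: "real \<Rightarrow> ('a::euclidean_space \<Rightarrow> ereal) \<Rightarrow> 'a \<Rightarrow> 'a" where
  "prox \<gamma> \<phi> z = arg_min (\<lambda>x. \<phi> x + ereal (1 / (2 * \<gamma>) * (norm (x - z))\<^sup>2)) (\<lambda>_. True)"

definition r_fun :: "real \<Rightarrow> ('a::euclidean_space \<Rightarrow> ereal) \<Rightarrow> 'a \<Rightarrow> ereal" where
  "r_fun \<gamma> \<phi> x = ereal \<gamma> * \<phi> x + ereal (1 / 2 * (norm x)\<^sup>2)"

text \<open>\<open>p2_fun \<gamma> \<phi>\<close> is \<open>p\<^sup>2\<close> with index \<open>\<gamma>\<phi>\<close>; the square belongs to the name of the function.\<close>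

definition p2_fun :: "real \<Rightarrow> ('a::euclidean_space \<Rightarrow> ereal) \<Rightarrow> 'a \<Rightarrow> ereal" where
  "p2_fun \<gamma> \<phi> x = 2 * conjugate (r_fun \<gamma> \<phi>) x - ereal (1 / 2 * (norm x)\<^sup>2)"

definition refl_prox :: "real \<Rightarrow> ('a::euclidean_space \<Rightarrow> ereal) \<Rightarrow> 'a \<Rightarrow> 'a" where
  "refl_prox \<gamma> \<phi> z = 2 *\<^sub>R prox \<gamma> \<phi> z - z"

definition DR_envelope ::
  "real \<Rightarrow> ('a::euclidean_space \<Rightarrow> ereal) \<Rightarrow> ('a \<Rightarrow> ereal) \<Rightarrow> 'a \<Rightarrow> ereal" where
  "DR_envelope \<gamma> f g z =
     ereal (1 / (2 * \<gamma>)) *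
       (ereal (refl_prox \<gamma> f z \<bullet> z) - p2_fun \<gamma> f z - p2_fun \<gamma> g (refl_prox \<gamma> f z))"

end

(* Completing the square gives R_{gamma f}(z) = P z - a with a fixed vector a, and
   2 gamma F(z) = 1/2 <P z, z> - p_{gamma g}^2 (R_{gamma f}(z)) + constant. The conjugate of r_{gamma g}
   is convex and 1-smooth, so the first-order remainder of p_{gamma g}^2 at distance d lies between
   -|d|^2/2 and |d|^2/2; at d = P (z - y) this is the P^2 term of the claim. Positivity of P - P^2 is
   tested on x = (Id + gamma H) u, where P x = u - gamma H u and the claim becomes
   gamma |H u|^2 < <H u, u>; this follows from |H u|^2 <= L <H u, u>, the Cauchy-Schwarz inequality for
   the form of H, so no spectral decomposition is needed. *)

theory Submission
  imports Defs
begin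

section \<open>Quadratic forms of self-adjoint operators and their eigenvalue bounds\<close>

lemma self_adjointD:
  assumes "self_adjoint Q"
  shows "linear Q" "Q x \<bullet> y = x \<bullet> Q y"
  using assms by (auto simp: self_adjoint_def)

lemma sqnorm_add:
  assumes "self_adjoint Q"
  shows "sqnorm Q (x + y) = sqnorm Q x + 2 * (Q x \<bullet> y) + sqnorm Q y"
  using self_adjointD[OF assms]
  by (simp add: sqnorm_def linear_add inner_simps inner_commute)

lemma sqnorm_scaleR:
  assumes "linear Q"
  shows "sqnorm Q (t *\<^sub>R x) = t\<^sup>2 * sqnorm Q x"
  using assms by (simp add: sqnorm_def linear_scale power2_eq_square)

text \<open>The form may be degenerate, so it need not come from an inner product. The bound holds
  because the polynomial \<open>sqnorm Q (x + t y)\<close> in \<open>t\<close> is never negative; if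
  \<open>sqnorm Q y = 0\<close>, it is affine and its slope must vanish.\<close>

lemma sqnorm_Cauchy_Schwarz:
  assumes sa: "self_adjoint Q" and psd: "\<And>x. 0 \<le> sqnorm Q x"
  shows "(Q x \<bullet> y)\<^sup>2 \<le> sqnorm Q x * sqnorm Q y"
proof -
  have quad: "0 \<le> sqnorm Q x + 2 * t * (Q x \<bullet> y) + t\<^sup>2 * sqnorm Q y" for t
    using psd[of "x + t *\<^sub>R y"]
    by (simp add: sqnorm_add[OF sa] sqnorm_scaleR self_adjointD[OF sa] mult.assoc)
  show ?thesis
  proof (cases "sqnorm Q y = 0")
    case True
    have "Q x \<bullet> y = 0"
    proof (rule ccontr)
      assume "Q x \<bullet> y \<noteq> 0"
      \<comment> \<open>This \<open>t\<close> would give the affine polynomial the value -1.\<close>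
      then show False
        using quad[of "- (sqnorm Q x + 1) / (2 * (Q x \<bullet> y))"] True by (simp add: field_simps)
    qed
    then show ?thesis using True by simp
  next
    case False
    then have "sqnorm Q y > 0" using psd[of y] by simp
    \<comment> \<open>This \<open>t\<close> is the minimiser of the quadratic polynomial.\<close>
    then show ?thesis
      using quad[of "- (Q x \<bullet> y) / sqnorm Q y"]
      by (simp add: field_simps power2_eq_square)
  qed
qed

text \<open>Compactness of the unit sphere gives a minimiser \<open>v\<close> of the form, with
  value \<open>c\<close>. It is an eigenvector because the form of \<open>Q - c Id\<close> is
  nonnegative and vanishes at \<open>v\<close>.\<close>

lemma Rayleigh_minimum:
  fixes Q :: "'a::euclidean_space \<Rightarrow> 'a"
  assumes sa: "self_adjoint Q"
  obtains c where "c \<in> eigenvalues Q" "\<And>x. c * (norm x)\<^sup>2 \<le> sqnorm Q x"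
proof -
  note lin = self_adjointD(1)[OF sa]
  have "continuous_on (sphere 0 1) (sqnorm Q)"
    unfolding sqnorm_def[abs_def]
    by (intro continuous_intros linear_continuous_on linear_conv_bounded_linear[THEN iffD1] lin)
  moreover have "sphere (0::'a) 1 \<noteq> {}" by simp
  ultimately obtain v where v: "v \<in> sphere 0 1" and
    min: "\<And>u. u \<in> sphere 0 1 \<Longrightarrow> sqnorm Q v \<le> sqnorm Q u"
    using continuous_attains_inf[of "sphere (0::'a) 1" "sqnorm Q"] compact_sphere by blast
  define c where "c = sqnorm Q v"
  have bound: "c * (norm x)\<^sup>2 \<le> sqnorm Q x" for x
  proof (cases "x = 0")
    case False
    have "c \<le> sqnorm Q ((1 / norm x) *\<^sub>R x)"
      unfolding c_def using False by (intro min) simp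
    then show ?thesis using False
      by (simp add: sqnorm_scaleR[OF lin] field_simps)
  qed (simp add: sqnorm_def linear_0[OF lin])
  define T where "T x = Q x - c *\<^sub>R x" for x
  have linT: "linear T" unfolding T_def
    by (intro linear_compose_sub lin linear_compose_scale_right linear_id[unfolded id_def])
  have saT: "self_adjoint T"
    using linT self_adjointD(2)[OF sa] by (simp add: self_adjoint_def T_def inner_simps)
  have sqT: "sqnorm T x = sqnorm Q x - c * (norm x)\<^sup>2" for x
    by (simp add: sqnorm_def T_def inner_simps dot_square_norm)
  \<comment> \<open>Cauchy-Schwarz for the form of \<open>T\<close>, at \<open>v\<close> and
    \<open>T v\<close>: the vanishing factor \<open>sqnorm T v\<close> forces
    \<open>T v = 0\<close>.\<close>
  have "(T v \<bullet> T v)\<^sup>2 \<le> sqnorm T v * sqnorm T (T v)"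
    by (rule sqnorm_Cauchy_Schwarz[OF saT]) (simp add: sqT bound)
  also have "sqnorm T v = 0" using v by (simp add: sqT c_def)
  finally have "T v = 0" by simp
  then have "Q v = c *\<^sub>R v" by (simp add: T_def)
  moreover have "v \<noteq> 0" using v by auto
  ultimately have "c \<in> eigenvalues Q" unfolding eigenvalues_def by blast
  then show thesis using bound that by blast
qed

lemma sqnorm_lower_bound:
  assumes "self_adjoint Q" "\<And>c. c \<in> eigenvalues Q \<Longrightarrow> b \<le> c"
  shows "b * (norm x)\<^sup>2 \<le> sqnorm Q x"
proof -
  obtain c where "c \<in> eigenvalues Q" "c * (norm x)\<^sup>2 \<le> sqnorm Q x"
    using Rayleigh_minimum[OF assms(1)] by metis
  then show ?thesis
    using mult_right_mono[OF assms(2), of c "(norm x)\<^sup>2"] by simp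
qed

text \<open>Reduces to the lower bound for \<open>-Q\<close>, whose eigenvalues are the
  negatives.\<close>

lemma sqnorm_upper_bound:
  assumes sa: "self_adjoint Q" and ub: "\<And>c. c \<in> eigenvalues Q \<Longrightarrow> c \<le> b"
  shows "sqnorm Q x \<le> b * (norm x)\<^sup>2"
proof -
  have sa': "self_adjoint (\<lambda>x. - Q x)"
    using self_adjointD[OF sa] by (simp add: self_adjoint_def linear_compose_neg)
  have "- b \<le> c" if "c \<in> eigenvalues (\<lambda>x. - Q x)" for c
  proof -
    from that obtain v where "v \<noteq> 0" "- Q v = c *\<^sub>R v" unfolding eigenvalues_def by blast
    then have "- c \<in> eigenvalues Q" 
      unfolding eigenvalues_def by (auto simp: minus_equation_iff[of "Q v"] intro!: exI[of _ v])
    then show ?thesis using ub by force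
  qed
  then have "- b * (norm x)\<^sup>2 \<le> sqnorm (\<lambda>x. - Q x) x"
    by (rule sqnorm_lower_bound[OF sa'])
  then show ?thesis by (simp add: sqnorm_def)
qed

lemma pos_defI:
  assumes "self_adjoint Q" "\<And>x. x \<noteq> 0 \<Longrightarrow> 0 < sqnorm Q x"
  shows "pos_def Q"
proof -
  have "0 < c" if "v \<noteq> 0" "Q v = c *\<^sub>R v" for c v
    using assms(2)[OF that(1)] that by (simp add: sqnorm_def dot_square_norm zero_less_mult_iff)
  then show ?thesis
    using assms(1) by (auto simp: pos_def_def eigenvalues_def)
qed

text \<open>Needed because \<open>lambda_max\<close> and \<open>lambda_min\<close> are a
  \<open>Max\<close> and a \<open>Min\<close>. Eigenvectors of distinct eigenvalues are orthogonal,
  and an orthogonal set in a Euclidean space is finite.\<close>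

lemma finite_eigenvalues:
  assumes sa: "self_adjoint Q"
  shows "finite (eigenvalues Q)"
proof -
  define v where "v c = (SOME v. v \<noteq> 0 \<and> Q v = c *\<^sub>R v)" for c
  have v: "v c \<noteq> 0" "Q (v c) = c *\<^sub>R v c" if "c \<in> eigenvalues Q" for c
    using someI_ex[of "\<lambda>v. v \<noteq> 0 \<and> Q v = c *\<^sub>R v"] that
    unfolding v_def eigenvalues_def by blast+
  have orth: "v c \<bullet> v d = 0" if "c \<in> eigenvalues Q" "d \<in> eigenvalues Q" "c \<noteq> d" for c d
    using self_adjointD(2)[OF sa, of "v c" "v d"] v[OF that(1)] v[OF that(2)] that(3) by simp
  have "inj_on v (eigenvalues Q)"
    using orth v(1) by (metis inj_onI inner_eq_zero_iff)
  moreover have "pairwise orthogonal (v ` eigenvalues Q)"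
    using orth by (auto simp: pairwise_def orthogonal_def)
  then have "finite (v ` eigenvalues Q)"
    by (rule pairwise_orthogonal_imp_finite)
  ultimately show ?thesis by (simp add: finite_image_iff)
qed

section \<open>Minimisation over the epigraph of \<open>g\<close> and the conjugate of
  \<open>r_fun \<gamma> g\<close>\<close>

lemma epi_affine_minorant:
  assumes "proper_closed_convex g"
  obtains a b where "\<And>x r. (x, r) \<in> epi g \<Longrightarrow> a \<bullet> x + b \<le> r"
proof -
  from assms obtain x0 r0 where x0: "g x0 = ereal r0"
    unfolding proper_closed_convex_def by (metis ereal_cases)
  have "convex (epi g)" "closed (epi g)" "(x0, r0 - 1) \<notin> epi g"
    using assms x0 by (auto simp: proper_closed_convex_def epi_def)
  then obtain n \<beta> where sep: "n \<bullet> (x0, r0 - 1) < \<beta>" "\<forall>p\<in>epi g. n \<bullet> p > \<beta>"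
    using separating_hyperplane_closed_point by blast
  obtain u c where n: "n = (u, c)" by fastforce
  \<comment> \<open>The hyperplane separates two points above the same \<open>x0\<close>, so it is
    not vertical and can be solved for the last coordinate.\<close>
  have "n \<bullet> (x0, r0) > \<beta>" using sep(2) x0 by (simp add: epi_def)
  then have c: "c > 0" using sep(1) by (simp add: n inner_Pair algebra_simps)
  have "(- (1 / c) *\<^sub>R u) \<bullet> x + \<beta> / c \<le> r" if "(x, r) \<in> epi g" for x r
    using sep(2) that c by (force simp: n inner_Pair field_simps)
  then show thesis by (rule that)
qed

text \<open>On the epigraph the objective is real-valued and continuous and the domain is closed, so
  no semicontinuity argument is needed. The quadratic term dominates the affine minorant of
  \<open>g\<close>, which makes the sublevel set \<open>S\<close> bounded.\<close>

lemma epi_minimiser: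
  assumes g: "proper_closed_convex g" and \<gamma>: "0 < \<gamma>"
  obtains xm rm where "(xm, rm) \<in> epi g"
    "\<And>x r. (x, r) \<in> epi g \<Longrightarrow>
      \<gamma> * rm + (norm xm)\<^sup>2 / 2 - v \<bullet> xm \<le> \<gamma> * r + (norm x)\<^sup>2 / 2 - v \<bullet> x"
proof -
  define \<phi> where "\<phi> p = \<gamma> * snd p + (norm (fst p))\<^sup>2 / 2 - v \<bullet> fst p" for p :: "'a \<times> real"
  obtain a b where ab: "\<And>x r. (x, r) \<in> epi g \<Longrightarrow> a \<bullet> x + b \<le> r"
    using epi_affine_minorant[OF g] by blast
  from g obtain x0 r0 where "g x0 = ereal r0"
    unfolding proper_closed_convex_def by (metis ereal_cases)
  then have p0: "(x0, r0) \<in> epi g" by (simp add: epi_def)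
  define C where "C = \<phi> (x0, r0)"
  define S where "S = epi g \<inter> {p. \<phi> p \<le> C}"
  have cont: "continuous_on A \<phi>" for A
    unfolding \<phi>_def by (auto intro!: continuous_intros)
  have "closed S" unfolding S_def
    using g by (intro closed_Int closed_Collect_le cont continuous_on_const)
      (simp add: proper_closed_convex_def)
  moreover have "bounded S"
  proof -
    \<comment> \<open>Replacing \<open>r\<close> by its minorant \<open>a \<bullet> x + b\<close>
      and completing the square puts \<open>x\<close> in the ball of radius \<open>\<rho>\<close>
      around \<open>w\<close>. Then \<open>X\<close> bounds \<open>norm x\<close>, the minorant
      gives \<open>l\<close>, and the level \<open>C\<close> gives \<open>u\<close>.\<close>
    define w where "w = v - \<gamma> *\<^sub>R a"
    define \<rho> where "\<rho> = sqrt (2 * (C - \<gamma> * b) + (norm w)\<^sup>2)"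
    define X where "X = norm w + \<rho>"
    define l where "l = - (norm a * X + \<bar>b\<bar>)"
    define u where "u = (C + norm v * X) / \<gamma>"
    have "x \<in> cball w \<rho> \<and> r \<in> {l..u}" if p: "(x, r) \<in> S" for x r
    proof -
      have r: "a \<bullet> x + b \<le> r" and le: "\<gamma> * r + (norm x)\<^sup>2 / 2 - v \<bullet> x \<le> C"
        using p ab by (auto simp: S_def \<phi>_def)
      have "\<gamma> * (a \<bullet> x + b) \<le> \<gamma> * r" using r \<gamma> by simp
      with le have "(norm (x - w))\<^sup>2 \<le> 2 * (C - \<gamma> * b) + (norm w)\<^sup>2"
        by (simp add: w_def power2_norm_eq_inner inner_simps algebra_simps inner_commute)
      then have xw: "norm (x - w) \<le> \<rho>" unfolding \<rho>_def by (rule real_le_rsqrt)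
      then have X: "norm x \<le> X" unfolding X_def by norm
      have "\<bar>a \<bullet> x\<bar> \<le> norm a * norm x" by (rule Cauchy_Schwarz_ineq2)
      also have "\<dots> \<le> norm a * X" using X by (simp add: mult_left_mono)
      finally have "l \<le> r" using r unfolding l_def by linarith
      have "\<bar>v \<bullet> x\<bar> \<le> norm v * norm x" by (rule Cauchy_Schwarz_ineq2)
      also have "\<dots> \<le> norm v * X" using X by (simp add: mult_left_mono)
      finally have "\<gamma> * r \<le> C + norm v * X" using le zero_le_power2[of "norm x"] by linarith
      then have "r \<le> u" using \<gamma> by (simp add: u_def field_simps)
      with \<open>l \<le> r\<close> xw show ?thesis by (simp add: dist_norm norm_minus_commute)
    qed
    then have "S \<subseteq> cball w \<rho> \<times> {l..u}" by auto
    then show ?thesis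
      by (rule bounded_subset[rotated]) (intro bounded_Times bounded_cball bounded_closed_interval)
  qed
  ultimately have "compact S" by (simp add: compact_eq_bounded_closed)
  moreover have p0S: "(x0, r0) \<in> S" using p0 by (simp add: S_def C_def)
  ultimately obtain p where p: "p \<in> S" "\<And>q. q \<in> S \<Longrightarrow> \<phi> p \<le> \<phi> q"
    using continuous_attains_inf[of S \<phi>] cont by blast
  have "\<phi> p \<le> \<phi> q" if "q \<in> epi g" for q
    using p that p(2)[OF p0S] by (cases "q \<in> S") (auto simp: S_def C_def)
  then show thesis
    using that[of "fst p" "snd p"] p(1) by (force simp: S_def \<phi>_def)
qed

text \<open>Divide by \<open>t\<close> and let \<open>t\<close> tend to 0 from the right. This turns
  minimality along a segment into a variational inequality.\<close>

lemma nonneg_linear_coefficient: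
  fixes a b :: real
  assumes "\<And>t. 0 < t \<Longrightarrow> t \<le> 1 \<Longrightarrow> 0 \<le> t * a + t\<^sup>2 * b"
  shows "0 \<le> a"
proof (rule tendsto_lowerbound)
  show "((\<lambda>t. a + t * b) \<longlongrightarrow> a) (at_right 0)"
    by (auto intro!: tendsto_eq_intros)
  show "\<forall>\<^sub>F t in at_right 0. 0 \<le> a + t * b"
    using eventually_at_right_real[of 0 1, OF zero_less_one]
  proof eventually_elim
    case (elim t)
    then have "0 \<le> t * (a + t * b)"
      using assms[of t] by (simp add: algebra_simps power2_eq_square)
    then show ?case using elim by (simp add: zero_le_mult_iff)
  qed
qed simp

text \<open>The maximiser is a subgradient of the conjugate (lower bound); strong convexity of
  \<open>r_fun \<gamma> g\<close> with modulus 1 makes the conjugate 1-smooth (upper bound).\<close>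

lemma conjugate_r_fun_smooth:
  assumes g: "proper_closed_convex g" and \<gamma>: "0 < \<gamma>"
  obtains q p where "\<And>v. conjugate (r_fun \<gamma> g) v = ereal (q v)"
    "\<And>v w. 0 \<le> q w - q v - p v \<bullet> (w - v)"
    "\<And>v w. q w - q v - p v \<bullet> (w - v) \<le> (norm (w - v))\<^sup>2 / 2"
proof -
  have "\<exists>xr. xr \<in> epi g \<and> (\<forall>x r. (x, r) \<in> epi g \<longrightarrow>
      \<gamma> * snd xr + (norm (fst xr))\<^sup>2 / 2 - v \<bullet> fst xr \<le> \<gamma> * r + (norm x)\<^sup>2 / 2 - v \<bullet> x)" for v
  proof -
    obtain xm rm where "(xm, rm) \<in> epi g"
      "\<And>x r. (x, r) \<in> epi g \<Longrightarrow>
        \<gamma> * rm + (norm xm)\<^sup>2 / 2 - v \<bullet> xm \<le> \<gamma> * r + (norm x)\<^sup>2 / 2 - v \<bullet> x"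
      using epi_minimiser[OF g \<gamma>] by blast
    then show ?thesis by (intro exI[of _ "(xm, rm)"]) simp
  qed
  then obtain xr where "\<forall>v. xr v \<in> epi g \<and> (\<forall>x r. (x, r) \<in> epi g \<longrightarrow>
      \<gamma> * snd (xr v) + (norm (fst (xr v)))\<^sup>2 / 2 - v \<bullet> fst (xr v)
        \<le> \<gamma> * r + (norm x)\<^sup>2 / 2 - v \<bullet> x)"
    by metis
  define p where "p v = fst (xr v)" for v
  define \<rho> where "\<rho> v = snd (xr v)" for v
  have mem: "(p v, \<rho> v) \<in> epi g" for v
    using \<open>\<forall>v. _ v\<close> by (simp add: p_def \<rho>_def)
  have min: "\<gamma> * \<rho> v + (norm (p v))\<^sup>2 / 2 - v \<bullet> p v \<le> \<gamma> * r + (norm x)\<^sup>2 / 2 - v \<bullet> x"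
    if "(x, r) \<in> epi g" for v x r
    using \<open>\<forall>v. _ v\<close> that by (simp add: p_def \<rho>_def)
  define q where "q v = v \<bullet> p v - \<gamma> * \<rho> v - (norm (p v))\<^sup>2 / 2" for v
  have real_val: "g x = \<infinity> \<or> (\<exists>r. g x = ereal r \<and> (x, r) \<in> epi g)" for x
    using g by (cases "g x") (auto simp: proper_closed_convex_def epi_def)
  have conj: "conjugate (r_fun \<gamma> g) v = ereal (q v)" for v
    unfolding conjugate_def
  proof (rule antisym[OF SUP_least])
    fix x
    show "ereal (v \<bullet> x) - r_fun \<gamma> g x \<le> ereal (q v)"
    proof (cases "g x = \<infinity>")
      case False
      then obtain r where r: "g x = ereal r" "(x, r) \<in> epi g" using real_val by blast
      show ?thesis using min[OF r(2), of v] by (simp add: r_fun_def r(1) q_def)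
    qed (use \<gamma> in \<open>simp add: r_fun_def\<close>)
  next
    \<comment> \<open>So far \<open>\<rho> v\<close> is only an upper bound for
      \<open>g (p v)\<close>; minimality over the epigraph makes it the value, so the supremum is
      attained at \<open>p v\<close>.\<close>
    obtain r where r: "g (p v) = ereal r" "r \<le> \<rho> v" "(p v, r) \<in> epi g"
      using real_val[of "p v"] mem[of v] by (auto simp: epi_def)
    with min[OF r(3), of v] \<gamma> have "r = \<rho> v" by simp
    then have "ereal (q v) = ereal (v \<bullet> p v) - r_fun \<gamma> g (p v)"
      using r by (simp add: r_fun_def q_def)
    also have "\<dots> \<le> (SUP x. ereal (v \<bullet> x) - r_fun \<gamma> g x)"
      by (rule SUP_upper) simp
    finally show "ereal (q v) \<le> (SUP x. ereal (v \<bullet> x) - r_fun \<gamma> g x)" .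
  qed
  have lower: "0 \<le> q w - q v - p v \<bullet> (w - v)" for v w
    using min[OF mem[of v], of w] by (simp add: q_def inner_diff_right inner_commute)
  \<comment> \<open>First-order optimality of \<open>(p v, \<rho> v)\<close>: the segment to
    \<open>(x, r)\<close> stays in the convex epigraph, and the coefficient of \<open>t\<close>
    along it cannot be negative.\<close>
  have var: "0 \<le> \<gamma> * (r - \<rho> v) + (p v - v) \<bullet> (x - p v)" if x: "(x, r) \<in> epi g" for v x r
  proof (rule nonneg_linear_coefficient)
    fix t :: real assume t: "0 < t" "t \<le> 1"
    define d where "d = x - p v"
    have "convex (epi g)" using g by (simp add: proper_closed_convex_def)
    from convexD_alt[OF this mem[of v] x, of t] t
    have "(p v + t *\<^sub>R d, \<rho> v + t * (r - \<rho> v)) \<in> epi g"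
      by (simp add: d_def algebra_simps)
    note min[OF this, of v]
    moreover have "(norm (p v + t *\<^sub>R d))\<^sup>2 = (norm (p v))\<^sup>2 + 2 * t * (p v \<bullet> d) + t\<^sup>2 * (norm d)\<^sup>2"
      unfolding power2_norm_eq_inner
      by (simp add: inner_simps inner_commute power2_eq_square algebra_simps)
    ultimately show "0 \<le> t * (\<gamma> * (r - \<rho> v) + (p v - v) \<bullet> (x - p v)) + t\<^sup>2 * ((norm (x - p v))\<^sup>2 / 2)"
      unfolding d_def[symmetric]
      by (simp add: inner_simps inner_commute field_simps)
  qed
  \<comment> \<open>With \<open>d = p w - p v\<close>, the variational inequality tested at
    \<open>p w\<close> bounds the remainder by \<open>(w - v) \<bullet> d - |d|^2/2\<close>. The
    square of \<open>w - v - d\<close> supplies the rest.\<close>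
  have upper: "q w - q v - p v \<bullet> (w - v) \<le> (norm (w - v))\<^sup>2 / 2" for v w
    using var[OF mem[of w], of v] zero_le_power2[of "norm (w - v - (p w - p v))"]
    by (simp add: q_def power2_norm_eq_inner inner_simps inner_commute field_simps)
  show thesis using that conj lower upper by blast
qed

section \<open>From first-order inequalities to convexity and gradients\<close>

lemma convex_on_if_subgradient:
  fixes G :: "'a::real_inner \<Rightarrow> real"
  assumes sub: "\<And>y z. G y + D y \<bullet> (z - y) \<le> G z"
  shows "convex_on UNIV G"
proof (rule convex_onI)
  fix t :: real and x y :: 'a assume t: "0 < t" "t < 1"
  define w where "w = (1 - t) *\<^sub>R x + t *\<^sub>R y"
  have "(1 - t) * (G w + D w \<bullet> (x - w)) \<le> (1 - t) * G x"
    "t * (G w + D w \<bullet> (y - w)) \<le> t * G y"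
    using t by (intro mult_left_mono sub; simp)+
  \<comment> \<open>The weighted displacements from \<open>w\<close> sum to zero, so only the
    function values survive.\<close>
  moreover have "(1 - t) * (D w \<bullet> (x - w)) + t * (D w \<bullet> (y - w)) = 0"
    unfolding w_def by (simp add: inner_simps algebra_simps)
  ultimately show "G ((1 - t) *\<^sub>R x + t *\<^sub>R y) \<le> (1 - t) * G x + t * G y"
    unfolding w_def[symmetric] by (simp add: algebra_simps)
qed simp

text \<open>The difference quotient is at most \<open>C * norm h\<close>. Hence the two-sided
  estimate for the envelope itself yields differentiability.\<close>

lemma GDERIV_if_quadratic_error:
  fixes F :: "'a::euclidean_space \<Rightarrow> real"
  assumes err: "\<And>z. \<bar>F z - F y - D \<bullet> (z - y)\<bar> \<le> C * (norm (z - y))\<^sup>2"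
  shows "GDERIV F y :> D"
  unfolding gderiv_def has_derivative_at
proof (intro conjI)
  show "bounded_linear (\<lambda>h. h \<bullet> D)" by (rule bounded_linear_inner_left)
  show "(\<lambda>h. norm (F (y + h) - F y - h \<bullet> D) / norm h) \<midarrow>0\<rightarrow> 0"
  proof (rule Lim_null_comparison)
    show "\<forall>\<^sub>F h in at 0. norm (norm (F (y + h) - F y - h \<bullet> D) / norm h) \<le> C * norm h"
      unfolding eventually_at_filter
    proof (rule always_eventually, intro allI impI)
      fix h :: 'a assume "h \<noteq> 0"
      then show "norm (norm (F (y + h) - F y - h \<bullet> D) / norm h) \<le> C * norm h"
        using err[of "y + h"] by (simp add: field_simps power2_eq_square inner_commute)
    qed
    show "(\<lambda>h. C * norm h) \<midarrow>0\<rightarrow> 0" by (auto intro!: tendsto_eq_intros)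
  qed
qed

lemma gradient_eqI:
  assumes "GDERIV F y :> D"
  shows "gradient F y = D"
  unfolding gradient_def
proof (rule the_equality[where P = "\<lambda>D. GDERIV F y :> D", OF assms])
  fix E assume "GDERIV F y :> E"
  then have "(\<lambda>h. h \<bullet> E) = (\<lambda>h. h \<bullet> D)"
    using assms has_derivative_unique unfolding gderiv_def by blast
  then show "E = D" by (metis inner_eq_zero_iff inner_diff_right right_minus_eq)
qed


section \<open>The resolvent of \<open>H\<close>, and prox and conjugate for the quadratic
  \<open>f\<close>\<close>

lemma pos_semidef_sqnorm_nonneg:
  assumes "pos_semidef Q"
  shows "0 \<le> sqnorm Q x"
  using sqnorm_lower_bound[of Q 0 x] assms by (simp add: pos_semidef_def)

text \<open>Since the form of \<open>B\<close> dominates the squared norm, \<open>B\<close> is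
  injective, hence surjective in finite dimension, and \<open>inv B\<close> is a genuine two-sided
  inverse.\<close>

lemma resolvent:
  fixes H :: "'a::euclidean_space \<Rightarrow> 'a"
  assumes H: "pos_semidef H" and \<gamma>: "0 < \<gamma>" and B_def: "B = (\<lambda>u. u + \<gamma> *\<^sub>R H u)"
  shows "self_adjoint B" "(norm x)\<^sup>2 \<le> sqnorm B x" "B (inv B x) = x" "inv B (B x) = x"
    "self_adjoint (inv B)"
proof -
  have saH: "self_adjoint H" using H by (simp add: pos_semidef_def)
  have linB: "linear B" unfolding B_def
    by (intro linear_compose_add linear_id[unfolded id_def] linear_compose_scale_right
        self_adjointD(1)[OF saH])
  show saB: "self_adjoint B"
    using linB self_adjointD(2)[OF saH] by (simp add: self_adjoint_def B_def inner_simps)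
  have norm_le: "(norm x)\<^sup>2 \<le> sqnorm B x" for x
    using pos_semidef_sqnorm_nonneg[OF H, of x] \<gamma>
    by (simp add: sqnorm_def B_def inner_simps power2_norm_eq_inner)
  then show "(norm x)\<^sup>2 \<le> sqnorm B x" .
  have inj: "inj B"
    unfolding linear_injective_0[OF linB]
    using norm_le by (metis inner_zero_left norm_eq_zero power2_less_eq_zero_iff sqnorm_def)
  then have BA: "B (inv B x) = x" for x
    using linear_injective_imp_surjective[OF linB] by (simp add: surj_f_inv_f)
  then show "B (inv B x) = x" .
  show "inv B (B x) = x" using inj by simp
  have "linear (inv B)"
  proof
    fix x y show "inv B (x + y) = inv B x + inv B y"
      by (rule injD[OF inj]) (simp add: BA linear_add[OF linB])
  next
    fix c x show "inv B (c *\<^sub>R x) = c *\<^sub>R inv B x"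
      by (rule injD[OF inj]) (simp add: BA linear_scale[OF linB])
  qed
  moreover have "inv B x \<bullet> y = x \<bullet> inv B y" for x y
    using self_adjointD(2)[OF saB, of "inv B x" "inv B y"] by (simp add: BA)
  ultimately show "self_adjoint (inv B)" by (simp add: self_adjoint_def)
qed

text \<open>The centre \<open>k\<close> is the stationary point, where
  \<open>B k = z - \<gamma> h\<close>. This one identity serves both the prox and the conjugate of
  \<open>f\<close>.\<close>

lemma quadratic_complete_square:
  fixes H :: "'a::euclidean_space \<Rightarrow> 'a" and h z x :: 'a
  assumes H: "pos_semidef H" and \<gamma>: "0 < \<gamma>" and B_def: "B = (\<lambda>u. u + \<gamma> *\<^sub>R H u)"
    and k_def: "k = inv B (z - \<gamma> *\<^sub>R h)"
  shows "\<gamma> * (1 / 2 * (H x \<bullet> x) + h \<bullet> x) + (norm x)\<^sup>2 / 2 - z \<bullet> x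
    = sqnorm B (x - k) / 2 - k \<bullet> (z - \<gamma> *\<^sub>R h) / 2"
proof -
  note B = resolvent[OF H \<gamma> B_def]
  have Bk: "B k = z - \<gamma> *\<^sub>R h" unfolding k_def by (rule B)
  have "sqnorm B (x - k) = sqnorm B x - 2 * (B k \<bullet> x) + B k \<bullet> k"
    using self_adjointD[OF B(1)] by (simp add: sqnorm_def linear_diff inner_simps inner_commute)
  moreover have "sqnorm B x = (norm x)\<^sup>2 + \<gamma> * (H x \<bullet> x)"
    by (simp add: sqnorm_def B_def inner_simps power2_norm_eq_inner)
  ultimately show ?thesis
    by (simp add: Bk inner_simps inner_commute field_simps)
qed

lemma prox_quadratic:
  fixes H :: "'a::euclidean_space \<Rightarrow> 'a"
  assumes H: "pos_semidef H" and \<gamma>: "0 < \<gamma>"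
  shows "prox \<gamma> (\<lambda>x. ereal (1 / 2 * (H x \<bullet> x) + h \<bullet> x)) z
    = inv (\<lambda>u. u + \<gamma> *\<^sub>R H u) (z - \<gamma> *\<^sub>R h)"
proof -
  define B where "B = (\<lambda>u. u + \<gamma> *\<^sub>R H u)"
  define k where "k = inv B (z - \<gamma> *\<^sub>R h)"
  define \<phi> where "\<phi> x = 1 / 2 * (H x \<bullet> x) + h \<bullet> x + 1 / (2 * \<gamma>) * (norm (x - z))\<^sup>2" for x
  note B = resolvent[OF H \<gamma> B_def]
  have expand: "\<gamma> * \<phi> x = \<gamma> * (1 / 2 * (H x \<bullet> x) + h \<bullet> x) + (norm x)\<^sup>2 / 2 - z \<bullet> x + (norm z)\<^sup>2 / 2" for x
    using \<gamma> by (simp add: \<phi>_def power2_norm_eq_inner inner_simps inner_commute field_simps)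
  have \<phi>: "\<gamma> * \<phi> x = sqnorm B (x - k) / 2 - k \<bullet> (z - \<gamma> *\<^sub>R h) / 2 + (norm z)\<^sup>2 / 2" for x
    by (simp only: expand quadratic_complete_square[OF H \<gamma> B_def k_def])
  have gap: "\<gamma> * \<phi> k + (norm (x - k))\<^sup>2 / 2 \<le> \<gamma> * \<phi> x" for x
    using \<phi>[of x] \<phi>[of k] B(2)[of "x - k"] linear_0[OF self_adjointD(1)[OF B(1)]]
    by (simp add: sqnorm_def)
  have "\<phi> k \<le> \<phi> x" for x
  proof -
    have "\<gamma> * \<phi> k \<le> \<gamma> * \<phi> x" using gap[of x] zero_le_power2[of "norm (x - k)"] by linarith
    then show ?thesis using \<gamma> by simp
  qed
  \<comment> \<open>The choice made by \<open>arg_min\<close> is known only to have the minimal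
    value; the quadratic \<open>gap\<close> then identifies the point as \<open>k\<close>.\<close>
  then have "ereal (\<phi> (arg_min (\<lambda>x. ereal (\<phi> x)) (\<lambda>_. True))) = ereal (\<phi> k)"
    by (intro arg_min_equality) auto
  then have "arg_min (\<lambda>x. ereal (\<phi> x)) (\<lambda>_. True) = k"
    using gap[of "arg_min (\<lambda>x. ereal (\<phi> x)) (\<lambda>_. True)"] by simp
  then show ?thesis by (simp add: prox_def \<phi>_def k_def B_def)
qed

text \<open>The supremum is attained at \<open>k\<close>, where the completed square vanishes and
  only its constant term is left.\<close>

lemma conjugate_r_fun_quadratic:
  fixes H :: "'a::euclidean_space \<Rightarrow> 'a"
  assumes H: "pos_semidef H" and \<gamma>: "0 < \<gamma>"
  shows "conjugate (r_fun \<gamma> (\<lambda>x. ereal (1 / 2 * (H x \<bullet> x) + h \<bullet> x))) z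
    = ereal (sqnorm (inv (\<lambda>u. u + \<gamma> *\<^sub>R H u)) (z - \<gamma> *\<^sub>R h) / 2)"
proof -
  define B where "B = (\<lambda>u. u + \<gamma> *\<^sub>R H u)"
  define k where "k = inv B (z - \<gamma> *\<^sub>R h)"
  note B = resolvent[OF H \<gamma> B_def]
  define c where "c = sqnorm (inv B) (z - \<gamma> *\<^sub>R h) / 2"
  have eq: "ereal (z \<bullet> x) - r_fun \<gamma> (\<lambda>x. ereal (1 / 2 * (H x \<bullet> x) + h \<bullet> x)) x
    = ereal (c - sqnorm B (x - k) / 2)" for x
    using quadratic_complete_square[OF H \<gamma> B_def k_def, of x]
    by (simp add: r_fun_def c_def sqnorm_def k_def)
  have "(SUP x. ereal (c - sqnorm B (x - k) / 2)) = ereal c"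
  proof (rule antisym[OF SUP_least])
    fix x
    have "0 \<le> sqnorm B (x - k)" using B(2)[of "x - k"] zero_le_power2 order_trans by blast
    then show "ereal (c - sqnorm B (x - k) / 2) \<le> ereal c" by simp
  next
    have "ereal c = ereal (c - sqnorm B (k - k) / 2)"
      using linear_0[OF self_adjointD(1)[OF B(1)]] by (simp add: sqnorm_def)
    also have "\<dots> \<le> (SUP x. ereal (c - sqnorm B (x - k) / 2))"
      by (rule SUP_upper) simp
    finally show "ereal c \<le> (SUP x. ereal (c - sqnorm B (x - k) / 2))" .
  qed
  then show ?thesis unfolding conjugate_def eq by (simp add: c_def B_def)
qed

lemma sqnorm_le_norm_power2:
  fixes Q :: "'a::euclidean_space \<Rightarrow> 'a"
  assumes "linear Q"
  obtains C where "\<And>x. \<bar>sqnorm Q x\<bar> \<le> C * (norm x)\<^sup>2"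
proof -
  obtain C where C: "\<And>x. norm (Q x) \<le> C * norm x"
    using linear_bounded[OF assms] by blast
  have "\<bar>sqnorm Q x\<bar> \<le> C * (norm x)\<^sup>2" for x
    using Cauchy_Schwarz_ineq2[of "Q x" x] mult_right_mono[OF C[of x], of "norm x"]
    by (simp add: sqnorm_def power2_eq_square mult.assoc)
  then show thesis by (rule that)
qed

theorem proposition4p5:
  fixes H :: "'a::euclidean_space \<Rightarrow> 'a" and h :: 'a
    and f :: "'a \<Rightarrow> real" and g :: "'a \<Rightarrow> ereal"
    and \<gamma> :: real and F :: "'a \<Rightarrow> real" and P :: "'a \<Rightarrow> 'a"
  assumes H: "pos_semidef H"
    and f: "f = (\<lambda>x. 1 / 2 * (H x \<bullet> x) + h \<bullet> x)"
    and g: "proper_closed_convex g"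
    and gamma: "0 < \<gamma>" "lambda_max H \<noteq> 0 \<longrightarrow> \<gamma> < 1 / lambda_max H"
    and F: "F = (\<lambda>z. real_of_ereal (DR_envelope \<gamma> (\<lambda>x. ereal (f x)) g z))"
    and P: "P = (\<lambda>x. 2 *\<^sub>R inv (\<lambda>u. u + \<gamma> *\<^sub>R H u) x - x)"
  shows "(\<forall>z. DR_envelope \<gamma> (\<lambda>x. ereal (f x)) g z = ereal (F z))
    \<and> (\<forall>y. GDERIV F y :> gradient F y)
    \<and> pos_def P
    \<and> (\<forall>y z.
          1 / (4 * \<gamma>) * sqnorm (\<lambda>x. P x - P (P x)) (z - y)
            \<le> F z - F y - gradient F y \<bullet> (z - y)
        \<and> F z - F y - gradient F y \<bullet> (z - y)
            \<le> 1 / (4 * \<gamma>) * sqnorm (\<lambda>x. P x + P (P x)) (z - y))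
    \<and> (0 < lambda_min H \<longrightarrow>
          pos_def (\<lambda>x. P x - P (P x))
        \<and> strongly_convex_wrt (\<lambda>x. P x - P (P x)) (1 / (2 * \<gamma>)) F)"
proof -
  define B where "B = (\<lambda>u. u + \<gamma> *\<^sub>R H u)"
  note B = resolvent[OF H gamma(1) B_def]
  have P': "P x = 2 *\<^sub>R inv B x - x" for x by (simp add: P B_def)
  have saH: "self_adjoint H" using H by (simp add: pos_semidef_def)
  have linP: "linear P"
    unfolding P'[abs_def]
    by (intro linear_compose_sub linear_id[unfolded id_def] linear_compose_scale_right
        self_adjointD(1)[OF B(5)])
  have saP: "self_adjoint P"
    using linP self_adjointD(2)[OF B(5)] by (simp add: self_adjoint_def P' inner_simps)
  \<comment> \<open>\<open>P\<close> is the Cayley transform of \<open>\<gamma> H\<close>; on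
    vectors \<open>B u\<close> the inverse disappears.\<close>
  have PB: "P (B u) = u - \<gamma> *\<^sub>R H u" for u
    by (simp add: P' B(4)) (simp add: B_def algebra_simps scaleR_2)

  \<comment> \<open>Spectral bounds on \<open>H\<close> and positivity of \<open>P\<close> and
    \<open>P - P^2\<close>\<close>
  define L where "L = lambda_max H"
  have L: "c \<le> L" if "c \<in> eigenvalues H" for c
    using Max_ge[OF finite_eigenvalues[OF saH] that] by (simp add: L_def lambda_max_def)
  have H_le: "sqnorm H u \<le> L * (norm u)\<^sup>2" for u
    by (rule sqnorm_upper_bound[OF saH L])
  \<comment> \<open>For \<open>L = 0\<close> the step size is unbounded, but the product is then
    0.\<close>
  have \<gamma>L: "\<gamma> * L < 1"
  proof (cases "L > 0")
    case True then show ?thesis using gamma by (simp add: L_def field_simps)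
  next
    case False
    then have "\<gamma> * L \<le> 0" using gamma(1) by (simp add: mult_le_0_iff)
    then show ?thesis by simp
  qed
  have H2: "(norm (H u))\<^sup>2 \<le> L * sqnorm H u" for u
  proof (cases "H u = 0")
    case False
    have "((norm (H u))\<^sup>2)\<^sup>2 \<le> sqnorm H u * sqnorm H (H u)"
      using sqnorm_Cauchy_Schwarz[OF saH pos_semidef_sqnorm_nonneg[OF H], of u "H u"]
      by (simp add: power2_norm_eq_inner)
    also have "\<dots> \<le> sqnorm H u * (L * (norm (H u))\<^sup>2)"
      by (intro mult_left_mono H_le pos_semidef_sqnorm_nonneg H)
    finally have "(norm (H u))\<^sup>2 * (norm (H u))\<^sup>2 \<le> (L * sqnorm H u) * (norm (H u))\<^sup>2"
      by (simp add: power2_eq_square mult_ac)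
    then show ?thesis by (rule mult_right_le_imp_le) (use False in simp)
  qed (simp add: sqnorm_def)
  have \<gamma>H2: "\<gamma> * (norm (H u))\<^sup>2 \<le> \<gamma> * L * sqnorm H u" for u
    using H2[of u] gamma(1) by simp

  have posP: "pos_def P"
  proof (rule pos_defI[OF saP])
    fix x :: 'a assume "x \<noteq> 0"
    define u where "u = inv B x"
    have x: "x = B u" by (simp add: u_def B(3))
    have "u \<noteq> 0" using \<open>x \<noteq> 0\<close> linear_0[OF self_adjointD(1)[OF B(1)]] by (auto simp: x)
    \<comment> \<open>The mixed terms of
      \<open>(u - \<gamma> H u) \<bullet> (u + \<gamma> H u)\<close> cancel. It remains to see that
      \<open>\<gamma> H\<close> strictly shrinks \<open>u\<close>, which follows from
      \<open>\<gamma> L < 1\<close>.\<close>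
    have "sqnorm P x = (norm u)\<^sup>2 - \<gamma> * (\<gamma> * (norm (H u))\<^sup>2)"
      unfolding sqnorm_def x PB unfolding B_def
      by (simp add: power2_norm_eq_inner inner_simps inner_commute)
    moreover have "\<gamma> * (\<gamma> * (norm (H u))\<^sup>2) < (norm u)\<^sup>2"
    proof -
      have "\<gamma> * (norm (H u))\<^sup>2 \<le> 1 * sqnorm H u"
        using \<gamma>H2[of u] mult_right_mono[OF less_imp_le[OF \<gamma>L] pos_semidef_sqnorm_nonneg[OF H, of u]]
        by linarith
      then have "\<gamma> * (\<gamma> * (norm (H u))\<^sup>2) \<le> \<gamma> * sqnorm H u" using gamma(1) by simp
      also have "\<dots> \<le> (\<gamma> * L) * (norm u)\<^sup>2" using H_le[of u] gamma(1) by simp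
      also have "\<dots> < 1 * (norm u)\<^sup>2" using \<gamma>L \<open>u \<noteq> 0\<close> by (intro mult_strict_right_mono) auto
      finally show ?thesis by simp
    qed
    ultimately show "0 < sqnorm P x" by simp
  qed

  have saPP: "self_adjoint (\<lambda>x. P x - P (P x))"
    using linP self_adjointD(2)[OF saP] linear_compose[OF linP linP]
    by (auto simp: self_adjoint_def inner_simps o_def intro!: linear_compose_sub)
  have posPP: "pos_def (\<lambda>x. P x - P (P x))" if "0 < lambda_min H"
  proof (rule pos_defI[OF saPP])
    fix x :: 'a assume "x \<noteq> 0"
    define u where "u = inv B x"
    have x: "x = B u" by (simp add: u_def B(3))
    have "u \<noteq> 0" using \<open>x \<noteq> 0\<close> linear_0[OF self_adjointD(1)[OF B(1)]] by (auto simp: x)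
    have "lambda_min H * (norm u)\<^sup>2 \<le> sqnorm H u"
      using Min_le[OF finite_eigenvalues[OF saH]]
      by (intro sqnorm_lower_bound[OF saH]) (simp add: lambda_min_def)
    moreover have "0 < lambda_min H * (norm u)\<^sup>2" using that \<open>u \<noteq> 0\<close> by simp
    ultimately have "0 < sqnorm H u" by linarith
    then have "\<gamma> * L * sqnorm H u < 1 * sqnorm H u"
      using \<gamma>L by (intro mult_strict_right_mono)
    then have "\<gamma> * (norm (H u))\<^sup>2 < sqnorm H u" using \<gamma>H2[of u] by simp
    \<comment> \<open>By self-adjointness the form is \<open>P x \<bullet> (x - P x)\<close>, and
      \<open>x - P x = 2 \<gamma> H u\<close>.\<close>
    moreover have "sqnorm (\<lambda>x. P x - P (P x)) x = 2 * \<gamma> * (sqnorm H u - \<gamma> * (norm (H u))\<^sup>2)"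
    proof -
      have "sqnorm (\<lambda>x. P x - P (P x)) x = P x \<bullet> (x - P x)"
        using self_adjointD(2)[OF saP, of "P x" x]
        by (simp add: sqnorm_def inner_simps inner_commute)
      then show ?thesis unfolding x PB unfolding B_def
        by (simp add: sqnorm_def power2_norm_eq_inner inner_simps inner_commute algebra_simps)
    qed
    ultimately show "0 < sqnorm (\<lambda>x. P x - P (P x)) x" using gamma(1) by simp
  qed

  \<comment> \<open>The envelope in explicit form, its first-order remainder and its
    gradient\<close>
  obtain q p where q: "\<And>v. conjugate (r_fun \<gamma> g) v = ereal (q v)"
    and lower: "\<And>v w. 0 \<le> q w - q v - p v \<bullet> (w - v)"
    and upper: "\<And>v w. q w - q v - p v \<bullet> (w - v) \<le> (norm (w - v))\<^sup>2 / 2"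
    using conjugate_r_fun_smooth[OF g gamma(1)] by blast
  define a where "a = (2 * \<gamma>) *\<^sub>R inv B h"
  define R where "R z = P z - a" for z
  define c where "c = \<gamma>\<^sup>2 * sqnorm (inv B) h"
  have lin_inv: "linear (inv B)" by (rule self_adjointD(1)[OF B(5)])
  have refl: "refl_prox \<gamma> (\<lambda>x. ereal (f x)) z = R z" for z
    unfolding refl_prox_def f prox_quadratic[OF H gamma(1)]
    unfolding R_def P' a_def B_def[symmetric]
    by (simp add: linear_diff[OF lin_inv] linear_scale[OF lin_inv] algebra_simps)
  have p2f: "p2_fun \<gamma> (\<lambda>x. ereal (f x)) z = ereal (sqnorm P z / 2 - a \<bullet> z + c)" for z
  proof -
    have "sqnorm (inv B) (z - \<gamma> *\<^sub>R h)
        = sqnorm (inv B) z - 2 * \<gamma> * (inv B h \<bullet> z) + \<gamma>\<^sup>2 * sqnorm (inv B) h"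
      using self_adjointD[OF B(5)]
      by (simp add: sqnorm_def linear_diff linear_scale inner_simps inner_commute power2_eq_square)
    moreover have "sqnorm P z = 2 * sqnorm (inv B) z - (norm z)\<^sup>2"
      by (simp add: sqnorm_def P' inner_simps power2_norm_eq_inner)
    ultimately show ?thesis
      unfolding p2_fun_def f conjugate_r_fun_quadratic[OF H gamma(1)] B_def[symmetric]
      by (simp add: a_def c_def diff_divide_distrib add_divide_distrib)
  qed
  \<comment> \<open>The terms \<open>a \<bullet> z\<close> from \<open>R z \<bullet> z\<close> and
    from \<open>p2_fun\<close> of \<open>f\<close> cancel. That every quantity is real also shows
    the envelope to be finite everywhere.\<close>
  define F' where "F' z = 1 / (2 * \<gamma>) *
    (sqnorm P z / 2 - c - 2 * q (R z) + (norm (R z))\<^sup>2 / 2)" for z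
  have DR: "DR_envelope \<gamma> (\<lambda>x. ereal (f x)) g z = ereal (F' z)" for z
  proof -
    have "R z \<bullet> z = sqnorm P z - a \<bullet> z" by (simp add: R_def sqnorm_def inner_simps)
    then show ?thesis
      unfolding DR_envelope_def refl p2f unfolding p2_fun_def q
      by (simp add: F'_def algebra_simps)
  qed
  have F_eq: "F z = F' z" for z by (simp add: F DR)

  \<comment> \<open>Chain rule: \<open>2 p - Id\<close> is the gradient of
    \<open>2 q - |.|^2/2\<close>, evaluated at \<open>R y\<close>, and the linear part
    \<open>P\<close> of \<open>R\<close> is its own adjoint.\<close>
  define D where "D y = (1 / (2 * \<gamma>)) *\<^sub>R (P y - P (2 *\<^sub>R p (R y) - R y))" for y
  have PPd: "sqnorm (\<lambda>x. P x - P (P x)) d = sqnorm P d - (norm (P d))\<^sup>2"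
    "sqnorm (\<lambda>x. P x + P (P x)) d = sqnorm P d + (norm (P d))\<^sup>2" for d
    using self_adjointD(2)[OF saP, of "P d" d]
    by (simp_all add: sqnorm_def inner_simps power2_norm_eq_inner)
  \<comment> \<open>An exact identity: all quadratic parts are expanded, and only the remainder of
    \<open>q\<close> is left to estimate.\<close>
  have gap: "F z - F y - D y \<bullet> (z - y) = 1 / (4 * \<gamma>) *
      (sqnorm P (z - y) + (norm (P (z - y)))\<^sup>2 - 4 * (q (R z) - q (R y) - p (R y) \<bullet> (R z - R y)))"
    for y z
  proof -
    define d where "d = z - y"
    have z: "z = y + d" by (simp add: d_def)
    have Rz: "R z = R y + P d" by (simp add: R_def z linear_add[OF linP])
    have sq: "sqnorm P z = sqnorm P y + 2 * (P y \<bullet> d) + sqnorm P d"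
      unfolding z by (rule sqnorm_add[OF saP])
    have nR: "(norm (R z))\<^sup>2 = (norm (R y))\<^sup>2 + 2 * (R y \<bullet> P d) + (norm (P d))\<^sup>2"
      unfolding Rz by (simp add: power2_norm_eq_inner inner_simps inner_commute)
    have Dd: "D y \<bullet> d = 1 / (2 * \<gamma>) * (P y \<bullet> d - 2 * (p (R y) \<bullet> P d) + R y \<bullet> P d)"
      using self_adjointD[OF saP] by (simp add: D_def inner_simps linear_diff linear_scale diff_divide_distrib add_divide_distrib)
    have RR: "R z - R y = P d" by (simp add: Rz)
    show ?thesis
      unfolding F_eq F'_def sq nR d_def[symmetric] Dd RR
      using gamma(1) by (simp add: field_simps)
  qed
  have RR: "R z - R y = P (z - y)" for y z by (simp add: R_def linear_diff[OF linP])
  \<comment> \<open>The remainder of \<open>q\<close> enters with a minus sign, so its upper bound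
    gives the lower estimate and conversely. Four times \<open>|P d|^2/2\<close> changes
    \<open>+|P d|^2\<close> into \<open>-|P d|^2\<close>.\<close>
  have lowF: "1 / (4 * \<gamma>) * sqnorm (\<lambda>x. P x - P (P x)) (z - y) \<le> F z - F y - D y \<bullet> (z - y)" for y z
    unfolding gap PPd using upper[of "R z" "R y"] gamma(1)
    by (intro mult_left_mono) (auto simp: RR)
  have uppF: "F z - F y - D y \<bullet> (z - y) \<le> 1 / (4 * \<gamma>) * sqnorm (\<lambda>x. P x + P (P x)) (z - y)" for y z
    unfolding gap PPd using lower[of "R z" "R y"] gamma(1)
    by (intro mult_left_mono) auto
  have deriv: "GDERIV F y :> D y" for y
  proof -
    have "linear (\<lambda>x. P x + P (P x))" "linear (\<lambda>x. P x - P (P x))"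
      using linP linear_compose[OF linP linP]
      by (auto simp: o_def intro!: linear_compose_add linear_compose_sub)
    then obtain C1 C2 where C: "\<And>x. \<bar>sqnorm (\<lambda>x. P x + P (P x)) x\<bar> \<le> C1 * (norm x)\<^sup>2"
      "\<And>x. \<bar>sqnorm (\<lambda>x. P x - P (P x)) x\<bar> \<le> C2 * (norm x)\<^sup>2"
      by (metis sqnorm_le_norm_power2)
    \<comment> \<open>Absolute values of \<open>C1\<close> and \<open>C2\<close> give one
      nonnegative constant that covers both sides.\<close>
    have "\<bar>F z - F y - D y \<bullet> (z - y)\<bar> \<le> (1 / (4 * \<gamma>) * (\<bar>C1\<bar> + \<bar>C2\<bar>)) * (norm (z - y))\<^sup>2" for z
    proof -
      let ?n = "(norm (z - y))\<^sup>2"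
      have "C1 * ?n \<le> \<bar>C1\<bar> * ?n" "C2 * ?n \<le> \<bar>C2\<bar> * ?n" "0 \<le> \<bar>C1\<bar> * ?n" "0 \<le> \<bar>C2\<bar> * ?n"
        by (auto intro: mult_right_mono)
      then have "sqnorm (\<lambda>x. P x + P (P x)) (z - y) \<le> (\<bar>C1\<bar> + \<bar>C2\<bar>) * ?n"
        "- ((\<bar>C1\<bar> + \<bar>C2\<bar>) * ?n) \<le> sqnorm (\<lambda>x. P x - P (P x)) (z - y)"
        using C(1)[of "z - y"] C(2)[of "z - y"] by (auto simp: distrib_right)
      then have "1 / (4 * \<gamma>) * sqnorm (\<lambda>x. P x + P (P x)) (z - y)
            \<le> 1 / (4 * \<gamma>) * ((\<bar>C1\<bar> + \<bar>C2\<bar>) * ?n)"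
        "1 / (4 * \<gamma>) * (- ((\<bar>C1\<bar> + \<bar>C2\<bar>) * ?n))
            \<le> 1 / (4 * \<gamma>) * sqnorm (\<lambda>x. P x - P (P x)) (z - y)"
        using gamma(1) by (intro mult_left_mono; simp)+
      then show ?thesis using lowF[of z y] uppF[of z y] by (simp add: mult.assoc abs_le_iff)
    qed
    then show ?thesis by (rule GDERIV_if_quadratic_error)
  qed
  have grad: "gradient F y = D y" for y by (rule gradient_eqI[OF deriv])

  have "strongly_convex_wrt (\<lambda>x. P x - P (P x)) (1 / (2 * \<gamma>)) F"
  proof -
    let ?Q = "\<lambda>x. P x - P (P x)"
    have "convex_on UNIV (\<lambda>x. F x - 1 / (4 * \<gamma>) * sqnorm ?Q x)"
    \<comment> \<open>Expanding the form around \<open>y\<close> turns \<open>lowF\<close> into a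
      subgradient inequality; the subgradient is \<open>D y\<close> minus the gradient of the
      subtracted form.\<close>
    proof (rule convex_on_if_subgradient)
      fix y z
      have "sqnorm ?Q z = sqnorm ?Q y + 2 * (?Q y \<bullet> (z - y)) + sqnorm ?Q (z - y)"
        using sqnorm_add[OF saPP, of y "z - y"] by simp
      then have "1 / (4 * \<gamma>) * sqnorm ?Q z = 1 / (4 * \<gamma>) * sqnorm ?Q y
          + (1 / (2 * \<gamma>)) * (?Q y \<bullet> (z - y)) + 1 / (4 * \<gamma>) * sqnorm ?Q (z - y)"
        using gamma(1) by (simp add: field_simps)
      with lowF[of z y] show "F y - 1 / (4 * \<gamma>) * sqnorm ?Q y
          + (D y - (1 / (2 * \<gamma>)) *\<^sub>R ?Q y) \<bullet> (z - y) \<le> F z - 1 / (4 * \<gamma>) * sqnorm ?Q z"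
        unfolding inner_diff_left[of "D y"] inner_scaleR_left by linarith
    qed
    then show ?thesis by (simp add: strongly_convex_wrt_def)
  qed
  then show ?thesis
    using DR deriv posP posPP lowF uppF by (simp add: grad F_eq)
qed

end
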